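(* Let $\overline{(\cdot)}$ be the translation of $\lambda\mathbf{J}$ into the $\lambda$-calculus given by $\overline{t}=\lambda gk.(t:g,k)$, $(x:G,K)=xGK$, $(\lambda x.t:G,K)=[K(\lambda wx.w\,\overline{t});G]$, $(t(u,x.v):G,K)=(t:G^+,\lambda m.m\,(\lambda x.(v:G,K))\,\overline{u})$. If $t\rightarrow u$ in $\lambda\mathbf{J}$, then $\overline{t}\rightarrow^+_\beta\overline{u}$ in the $\lambda$-calculus.
   Context: $\lambda\mathbf{J}$: terms $t,u,v::=x\mid\lambda x.t\mid t(u,x.v)$ ($x$ bound in $v$; capture-avoiding substitution). A value $V$ is a variable or a $\lambda$-abstraction. Generalised arguments $R,S$ are pairs $(u,x.v)$, $tRS$ means $(tR)S$; $(u,x.V)@S=(u,x.VS)$, $(u,x.tR')@S=(u,x.t(R'@S))$. Reduction: closure under all constructors of $(\lambda x.t)(u,y.v)\rightarrow[[u/x]t/y]v$ and $tRS\rightarrow t(R@S)$. In the translation, $g,k,w,m$ are fresh variables, $[t;u]:=(\lambda y.t)u$ with $y$ not free in $t$, and $G^+:=\mathsf{s}\,G$ for a fixed closed $\lambda$-term $\mathsf{s}$ such that $\mathsf{s}\,G\rightarrow^+_\beta G$ for all $G$ (e.g. $\mathsf{s}=\lambda z.z$). *)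

theory Defs
  imports Main
begin

text \<open>Both calculi use de Bruijn indices, so that syntactic equality is alpha-equivalence.
  In each calculus \<open>lift t k\<close> shifts the free indices \<open>\<ge> k\<close> up by one, and
  \<open>subst t s k\<close> replaces index \<open>k\<close> by \<open>s\<close>, lowering the larger indices.\<close>

datatype lterm = Var nat | Lam lterm | App lterm lterm

primrec fv :: "lterm \<Rightarrow> nat set" where
  "fv (Var i) = {i}"
| "fv (Lam t) = {i. Suc i \<in> fv t}"
| "fv (App t u) = fv t \<union> fv u"

definition closed :: "lterm \<Rightarrow> bool" where
  "closed t \<longleftrightarrow> fv t = {}"

primrec lift :: "lterm \<Rightarrow> nat \<Rightarrow> lterm" where
  "lift (Var i) k = (if i < k then Var i else Var (Suc i))"
| "lift (Lam t) k = Lam (lift t (Suc k))"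
| "lift (App t u) k = App (lift t k) (lift u k)"

primrec subst :: "lterm \<Rightarrow> lterm \<Rightarrow> nat \<Rightarrow> lterm" where
  "subst (Var i) s k = (if k < i then Var (i - 1) else if i = k then s else Var i)"
| "subst (Lam t) s k = Lam (subst t (lift s 0) (Suc k))"
| "subst (App t u) s k = App (subst t s k) (subst u s k)"

inductive beta :: "lterm \<Rightarrow> lterm \<Rightarrow> bool" (infix "\<rightarrow>\<^sub>\<beta>" 50) where
  beta: "App (Lam t) u \<rightarrow>\<^sub>\<beta> subst t u 0"
| Lam: "t \<rightarrow>\<^sub>\<beta> t' \<Longrightarrow> Lam t \<rightarrow>\<^sub>\<beta> Lam t'"
| AppL: "t \<rightarrow>\<^sub>\<beta> t' \<Longrightarrow> App t u \<rightarrow>\<^sub>\<beta> App t' u"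
| AppR: "u \<rightarrow>\<^sub>\<beta> u' \<Longrightarrow> App t u \<rightarrow>\<^sub>\<beta> App t u'"

abbreviation beta_plus :: "lterm \<Rightarrow> lterm \<Rightarrow> bool" (infix "\<rightarrow>\<^sub>\<beta>\<^sup>+" 50) where
  "t \<rightarrow>\<^sub>\<beta>\<^sup>+ u \<equiv> beta\<^sup>+\<^sup>+ t u"

text \<open>\<open>JApp t u v\<close> is \<open>t(u, x.v)\<close>: index 0 is bound in the third argument.\<close>

datatype jterm = JVar nat | JLam jterm | JApp jterm jterm jterm

primrec jlift :: "jterm \<Rightarrow> nat \<Rightarrow> jterm" where
  "jlift (JVar i) k = (if i < k then JVar i else JVar (Suc i))"
| "jlift (JLam t) k = JLam (jlift t (Suc k))"
| "jlift (JApp t u v) k = JApp (jlift t k) (jlift u k) (jlift v (Suc k))"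

primrec jsubst :: "jterm \<Rightarrow> jterm \<Rightarrow> nat \<Rightarrow> jterm" where
  "jsubst (JVar i) s k = (if k < i then JVar (i - 1) else if i = k then s else JVar i)"
| "jsubst (JLam t) s k = JLam (jsubst t (jlift s 0) (Suc k))"
| "jsubst (JApp t u v) s k =
     JApp (jsubst t s k) (jsubst u s k) (jsubst v (jlift s 0) (Suc k))"

text \<open>The generalised argument \<open>(u, x.v)\<close> is the pair \<open>(u, v)\<close>, with index 0 bound in \<open>v\<close>.\<close>

type_synonym garg = "jterm \<times> jterm"

fun japp :: "jterm \<Rightarrow> garg \<Rightarrow> jterm" where
  "japp t (u, v) = JApp t u v"

fun glift :: "garg \<Rightarrow> garg" where
  "glift (u, v) = (jlift u 0, jlift v 1)"

text \<open>\<open>R @ S\<close>. Appending goes below the binder of \<open>R\<close>, hence the lifting of \<open>S\<close>; the first two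
  equations are the case of a value.\<close>

function gappend :: "garg \<Rightarrow> garg \<Rightarrow> garg" where
  "gappend (u, JVar i) S = (u, japp (JVar i) (glift S))"
| "gappend (u, JLam t) S = (u, japp (JLam t) (glift S))"
| "gappend (u, JApp t u' v') S = (u, japp t (gappend (u', v') (glift S)))"
  by pat_completeness auto
termination
  by (relation "measure (\<lambda>(R, S). size (snd R))") auto

inductive jred :: "jterm \<Rightarrow> jterm \<Rightarrow> bool" (infix "\<rightarrow>\<^sub>J" 50) where
  beta: "JApp (JLam t) u v \<rightarrow>\<^sub>J jsubst v (jsubst t u 0) 0"
| pi: "japp (japp t R) S \<rightarrow>\<^sub>J japp t (gappend R S)"
| JLam: "t \<rightarrow>\<^sub>J t' \<Longrightarrow> JLam t \<rightarrow>\<^sub>J JLam t'"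
| JApp1: "t \<rightarrow>\<^sub>J t' \<Longrightarrow> JApp t u v \<rightarrow>\<^sub>J JApp t' u v"
| JApp2: "u \<rightarrow>\<^sub>J u' \<Longrightarrow> JApp t u v \<rightarrow>\<^sub>J JApp t u' v"
| JApp3: "v \<rightarrow>\<^sub>J v' \<Longrightarrow> JApp t u v \<rightarrow>\<^sub>J JApp t u v'"

text \<open>\<open>[t; u] = (\<lambda>y. t) u\<close> with \<open>y\<close> not free in \<open>t\<close>.\<close>

definition garbage :: "lterm \<Rightarrow> lterm \<Rightarrow> lterm" where
  "garbage t u = App (Lam (lift t 0)) u"

lemma size_jlift [simp]: "size (jlift t k) = size t"
  by (induction t arbitrary: k) auto

text \<open>\<open>cps s t\<close> is the translation of \<open>t\<close> and \<open>colon s t G K\<close> is \<open>(t : G, K)\<close>, where the garbage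
  increment is \<open>G\<^sup>+ = s G\<close>. Freshness of \<open>g\<close>, \<open>k\<close>, \<open>w\<close>, \<open>m\<close> is expressed by lifting. In the
  \<open>JLam\<close> clause, \<open>\<lambda>w x. w t\<close> puts the binder of \<open>w\<close> outside that of \<open>x\<close>, so the translated body
  is lifted at 1, not at 0. The term \<open>s\<close> is not lifted below binders: it is meant to be closed.\<close>

function cps :: "lterm \<Rightarrow> jterm \<Rightarrow> lterm"
  and colon :: "lterm \<Rightarrow> jterm \<Rightarrow> lterm \<Rightarrow> lterm \<Rightarrow> lterm" where
  "cps s t = Lam (Lam (colon s (jlift (jlift t 0) 0) (Var 1) (Var 0)))"
| "colon s (JVar i) G K = App (App (Var i) G) K"
| "colon s (JLam t) G K = garbage (App K (Lam (Lam (App (Var 1) (lift (cps s t) 1))))) G"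
| "colon s (JApp t u v) G K =
     colon s t (App s G)
       (Lam (App (App (Var 0) (lift (Lam (colon s v (lift G 0) (lift K 0))) 0))
                 (lift (cps s u) 0)))"
  by pat_completeness auto
termination
  by (relation "measure (case_sum (\<lambda>(s, t). 2 * size t + 1) (\<lambda>(s, t, G, K). 2 * size t))") auto

end

theory Submission
  imports Defs
begin

text \<open>The colon \<open>(t : G, K)\<close> never erases \<open>G\<close> or \<open>K\<close>, so it turns steps in either argument into at
  least one step. This makes \<open>\<pi>\<close> strict: the two sides of \<open>\<pi>\<close> share the continuation up to
  reduction, but the redex carries the garbage \<open>G\<^sup>+\<^sup>+\<close> where the contractum carries \<open>G\<^sup>+\<close>. For
  \<open>\<beta>\<close>, the garbage is dropped and the translation commutes with substitution up to \<open>\<rightarrow>\<^sup>*\<close>, since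
  \<open>\<^bold>u G K \<rightarrow>\<^sup>* (u : G, K)\<close> for the translation \<open>\<^bold>u\<close> of \<open>u\<close>.\<close>

declare cps.simps [simp del]

section \<open>Lifting and substitution\<close>

lemma lift_lift: "i \<le> k \<Longrightarrow> lift (lift t i) (Suc k) = lift (lift t k) i"
  by (induction t arbitrary: i k) auto

lemma subst_lift [simp]: "subst (lift t k) r k = t"
  by (induction t arbitrary: k r) auto

lemma subst_lift_le: "i \<le> k \<Longrightarrow> subst (lift t i) (lift r i) (Suc k) = lift (subst t r k) i"
  by (induction t arbitrary: i k r) (auto simp flip: lift_lift[of 0])

lemma lift_subst_le:
  "i \<le> k \<Longrightarrow> lift (subst t r i) k = subst (lift t (Suc k)) (lift r k) i"
  by (induction t arbitrary: i k r) (auto simp: lift_lift)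

text \<open>The body of a closed abstraction need not be closed; the bound \<open>k\<close> lets the
  induction pass \<open>Lam\<close>.\<close>

lemma lift_fv_less: "\<forall>i\<in>fv t. i < k \<Longrightarrow> lift t k = t"
proof (induction t arbitrary: k)
  case (Lam t)
  have "\<forall>i\<in>fv t. i < Suc k"
    using Lam.prems by (auto simp: less_Suc_eq_0_disj) (metis not0_implies_Suc)
  then show ?case using Lam.IH by simp
qed auto

lemma subst_fv_less: "\<forall>i\<in>fv t. i < k \<Longrightarrow> subst t r k = t"
  by (metis lift_fv_less subst_lift)

lemma lift_closed: "closed t \<Longrightarrow> lift t k = t"
  by (simp add: closed_def lift_fv_less)

lemma subst_closed: "closed t \<Longrightarrow> subst t r k = t"
  by (simp add: closed_def subst_fv_less)

lemma jlift_jlift: "i \<le> k \<Longrightarrow> jlift (jlift t i) (Suc k) = jlift (jlift t k) i"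
  by (induction t arbitrary: i k) auto

lemma jsubst_jlift_le:
  "i \<le> k \<Longrightarrow> jsubst (jlift t i) (jlift r i) (Suc k) = jlift (jsubst t r k) i"
  by (induction t arbitrary: i k r) (auto simp flip: jlift_jlift[of 0])

lemma jlift_jsubst_le:
  "i \<le> k \<Longrightarrow> jlift (jsubst t r i) k = jsubst (jlift t (Suc k)) (jlift r k) i"
  by (induction t arbitrary: i k r) (auto simp: jlift_jlift)

section \<open>Compatible closure\<close>

lemma tranclp_map:
  assumes "\<And>x y. r x y \<Longrightarrow> q\<^sup>+\<^sup>+ (f x) (f y)" and "r\<^sup>+\<^sup>+ x y"
  shows "q\<^sup>+\<^sup>+ (f x) (f y)"
  using assms(2) by induction (auto intro: assms(1) tranclp_trans)

text \<open>Allowing several steps of \<open>q\<close> per step of \<open>r\<close> lets the strict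
  congruence lemmas serve as the hypothesis.\<close>

lemma rtranclp_map:
  assumes "\<And>x y. r x y \<Longrightarrow> q\<^sup>+\<^sup>+ (f x) (f y)" and "r\<^sup>*\<^sup>* x y"
  shows "q\<^sup>*\<^sup>* (f x) (f y)"
  using assms(2) by induction (auto intro: rtranclp_trans tranclp_into_rtranclp[OF assms(1)])

abbreviation beta_star :: "lterm \<Rightarrow> lterm \<Rightarrow> bool" (infix "\<rightarrow>\<^sub>\<beta>\<^sup>*" 50) where
  "t \<rightarrow>\<^sub>\<beta>\<^sup>* u \<equiv> beta\<^sup>*\<^sup>* t u"

lemma plus_Lam: "t \<rightarrow>\<^sub>\<beta>\<^sup>+ t' \<Longrightarrow> Lam t \<rightarrow>\<^sub>\<beta>\<^sup>+ Lam t'"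
  by (rule tranclp_map[where f = Lam]) (auto intro: beta.intros)

lemma plus_AppL: "t \<rightarrow>\<^sub>\<beta>\<^sup>+ t' \<Longrightarrow> App t u \<rightarrow>\<^sub>\<beta>\<^sup>+ App t' u"
  by (rule tranclp_map[where f = "\<lambda>t. App t u"]) (auto intro: beta.intros)

lemma plus_AppR: "u \<rightarrow>\<^sub>\<beta>\<^sup>+ u' \<Longrightarrow> App t u \<rightarrow>\<^sub>\<beta>\<^sup>+ App t u'"
  by (rule tranclp_map[where f = "App t"]) (auto intro: beta.intros)

lemma beta_lift: "t \<rightarrow>\<^sub>\<beta> t' \<Longrightarrow> lift t k \<rightarrow>\<^sub>\<beta> lift t' k"
  by (induction arbitrary: k rule: beta.induct) (auto simp: lift_subst_le intro: beta.intros)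

lemma plus_lift: "t \<rightarrow>\<^sub>\<beta>\<^sup>+ t' \<Longrightarrow> lift t k \<rightarrow>\<^sub>\<beta>\<^sup>+ lift t' k"
  by (rule tranclp_map[where f = "\<lambda>t. lift t k"]) (auto intro: beta_lift)

section \<open>Garbage and continuations\<close>

lemma lift_garbage [simp]: "lift (garbage t u) k = garbage (lift t k) (lift u k)"
  by (simp add: garbage_def lift_lift)

lemma subst_garbage [simp]: "subst (garbage t u) r k = garbage (subst t r k) (subst u r k)"
  by (simp add: garbage_def subst_lift_le)

lemma plus_garbageL: "t \<rightarrow>\<^sub>\<beta>\<^sup>+ t' \<Longrightarrow> garbage t u \<rightarrow>\<^sub>\<beta>\<^sup>+ garbage t' u"
  by (simp add: garbage_def plus_AppL plus_Lam plus_lift)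

lemma plus_garbageR: "u \<rightarrow>\<^sub>\<beta>\<^sup>+ u' \<Longrightarrow> garbage t u \<rightarrow>\<^sub>\<beta>\<^sup>+ garbage t u'"
  by (simp add: garbage_def plus_AppR)

lemma garbage_beta: "garbage t u \<rightarrow>\<^sub>\<beta> t"
  using beta.beta[of "lift t 0" u] by (simp add: garbage_def)

text \<open>\<open>\<lambda>m. m (\<lambda>x. M) U\<close>, where \<open>x\<close> is index 0 in \<open>M\<close>, and \<open>\<lambda>w x. w T\<close>, where \<open>x\<close> is index 0 in
  \<open>T\<close>.\<close>

definition kont :: "lterm \<Rightarrow> lterm \<Rightarrow> lterm" where
  "kont M U = Lam (App (App (Var 0) (lift (Lam M) 0)) (lift U 0))"

definition lamval :: "lterm \<Rightarrow> lterm" where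
  "lamval T = Lam (Lam (App (Var 1) (lift T 1)))"

lemma lift_kont [simp]: "lift (kont M U) k = kont (lift M (Suc k)) (lift U k)"
  by (simp add: kont_def lift_lift)

lemma subst_kont [simp]: "subst (kont M U) r k = kont (subst M (lift r 0) (Suc k)) (subst U r k)"
  using subst_lift_le[of 1 "Suc k" M "lift r 0"] by (simp add: kont_def subst_lift_le lift_lift)

lemma lift_lamval [simp]: "lift (lamval T) k = lamval (lift T (Suc k))"
  by (simp add: lamval_def lift_lift)

lemma subst_lamval [simp]: "subst (lamval T) r k = lamval (subst T (lift r 0) (Suc k))"
  using subst_lift_le[of 1 "Suc k" T "lift r 0"] by (simp add: lamval_def lift_lift)

lemma plus_kontL: "M \<rightarrow>\<^sub>\<beta>\<^sup>+ M' \<Longrightarrow> kont M U \<rightarrow>\<^sub>\<beta>\<^sup>+ kont M' U"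
  by (simp add: kont_def plus_Lam plus_AppL plus_AppR plus_lift)

lemma plus_kontR: "U \<rightarrow>\<^sub>\<beta>\<^sup>+ U' \<Longrightarrow> kont M U \<rightarrow>\<^sub>\<beta>\<^sup>+ kont M U'"
  by (simp add: kont_def plus_Lam plus_AppR plus_lift)

lemma plus_lamval: "T \<rightarrow>\<^sub>\<beta>\<^sup>+ T' \<Longrightarrow> lamval T \<rightarrow>\<^sub>\<beta>\<^sup>+ lamval T'"
  by (simp add: lamval_def plus_Lam plus_AppR plus_lift)

text \<open>The continuation receives the value and feeds it \<open>Lam M\<close> and
  \<open>U\<close>, which the value takes as its \<open>w\<close> and \<open>x\<close>.\<close>

lemma kont_lamval:
  "App (kont M U) (lamval T) \<rightarrow>\<^sub>\<beta>\<^sup>+ App (Lam M) (subst T U 0)"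
proof -
  have "App (kont M U) (lamval T) \<rightarrow>\<^sub>\<beta>\<^sup>+ App (App (lamval T) (Lam M)) U"
    using beta.beta[of "App (App (Var 0) (lift (Lam M) 0)) (lift U 0)" "lamval T"]
    \<comment> \<open>Keeping \<open>lift (Lam M) 0\<close> folded lets \<open>subst_lift\<close>
      cancel it.\<close>
    by (simp add: kont_def tranclp.r_into_trancl del: lift.simps(2))
  also have "\<dots> \<rightarrow>\<^sub>\<beta> App (Lam (App (lift (Lam M) 0) T)) U"
    using AppL[OF beta.beta[of "Lam (App (Var 1) (lift T 1))" "Lam M"]]
    by (simp add: lamval_def del: lift.simps(2))
  also have "\<dots> \<rightarrow>\<^sub>\<beta> App (Lam M) (subst T U 0)"
    using beta.beta[of "App (lift (Lam M) 0) T" U] by (simp del: lift.simps(2))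
  finally show ?thesis .
qed

section \<open>Lifting in the source calculus\<close>

text \<open>Extends \<open>glift\<close>, the case \<open>k = 0\<close>, to the indices met below
  binders.\<close>

definition gjlift :: "garg \<Rightarrow> nat \<Rightarrow> garg" where
  "gjlift R k = (jlift (fst R) k, jlift (snd R) (Suc k))"

lemma jlift_japp: "jlift (japp t R) k = japp (jlift t k) (gjlift R k)"
  by (cases R) (simp add: gjlift_def)

lemma gjlift_glift: "gjlift (glift S) (Suc k) = glift (gjlift S k)"
  by (cases S) (simp add: gjlift_def jlift_jlift)

lemma gjlift_gappend: "gjlift (gappend R S) k = gappend (gjlift R k) (gjlift S k)"
proof (induction R S arbitrary: k rule: gappend.induct)
  case (3 u t u' v' S)
  then show ?case
    by (simp add: gjlift_def[of "(_, _)"] jlift_japp gjlift_glift)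
qed (auto simp: gjlift_def[of "(_, _)"] jlift_japp gjlift_glift)

text \<open>Needed because \<open>cps s t\<close> lifts \<open>t\<close> past the binders of
  \<open>g\<close> and \<open>k\<close> before applying the colon.\<close>

lemma jred_jlift: "t \<rightarrow>\<^sub>J t' \<Longrightarrow> jlift t k \<rightarrow>\<^sub>J jlift t' k"
proof (induction arbitrary: k rule: jred.induct)
  case (pi t R S)
  then show ?case by (simp add: jlift_japp gjlift_gappend jred.pi)
qed (auto simp: jlift_jsubst_le intro: jred.intros)

section \<open>The translation\<close>

text \<open>With \<open>lamval\<close> and \<open>kont\<close> in the simp rules, the index shifts
  of the two clauses stay confined to the lemmas on these constants.\<close>

lemma colon_JLam: "colon s (JLam t) G K = garbage (App K (lamval (cps s t))) G"
  by (simp add: lamval_def)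

lemma colon_JApp:
  "colon s (JApp t u v) G K =
     colon s t (App s G) (kont (colon s v (lift G 0) (lift K 0)) (cps s u))"
  by (simp add: kont_def)

declare colon.simps(2,3) [simp del]
declare colon_JLam [simp] colon_JApp [simp]

text \<open>In the \<open>JApp\<close> clause \<open>K\<close> survives inside the new continuation,
  so the hypothesis for \<open>v\<close> feeds the one for \<open>t\<close>.\<close>

lemma colon_plus_cont: "K \<rightarrow>\<^sub>\<beta>\<^sup>+ K' \<Longrightarrow> colon s t G K \<rightarrow>\<^sub>\<beta>\<^sup>+ colon s t G K'"
  by (induction t arbitrary: G K K')
    (simp_all add: plus_AppR plus_AppL plus_garbageL plus_kontL plus_lift)

text \<open>The \<open>JApp\<close> clause holds \<open>G\<close> twice, as garbage and inside the
  continuation; the copies are reduced one after the other.\<close>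

lemma colon_plus_garbage: "G \<rightarrow>\<^sub>\<beta>\<^sup>+ G' \<Longrightarrow> colon s t G K \<rightarrow>\<^sub>\<beta>\<^sup>+ colon s t G' K"
proof (induction t arbitrary: G G' K)
  case (JApp t u v)
  have "colon s t (App s G) (kont (colon s v (lift G 0) (lift K 0)) (cps s u))
      \<rightarrow>\<^sub>\<beta>\<^sup>+ colon s t (App s G') (kont (colon s v (lift G 0) (lift K 0)) (cps s u))"
    using JApp by (simp add: plus_AppR)
  also have "\<dots> \<rightarrow>\<^sub>\<beta>\<^sup>+ colon s t (App s G') (kont (colon s v (lift G' 0) (lift K 0)) (cps s u))"
    using JApp by (simp add: colon_plus_cont plus_kontL plus_lift)
  finally show ?case by simp
qed (auto intro: plus_AppR plus_AppL plus_garbageR)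

lemma colon_star_cont: "K \<rightarrow>\<^sub>\<beta>\<^sup>* K' \<Longrightarrow> colon s t G K \<rightarrow>\<^sub>\<beta>\<^sup>* colon s t G K'"
  by (rule rtranclp_map[where f = "colon s t G"]) (auto intro: colon_plus_cont)

lemma star_kont:
  assumes "M \<rightarrow>\<^sub>\<beta>\<^sup>* M'" and "U \<rightarrow>\<^sub>\<beta>\<^sup>* U'"
  shows "kont M U \<rightarrow>\<^sub>\<beta>\<^sup>* kont M' U'"
proof -
  have "kont M U \<rightarrow>\<^sub>\<beta>\<^sup>* kont M' U"
    using assms(1) by (rule rtranclp_map[rotated]) (auto intro: plus_kontL)
  also have "\<dots> \<rightarrow>\<^sub>\<beta>\<^sup>* kont M' U'"
    using assms(2) by (rule rtranclp_map[rotated]) (auto intro: plus_kontR)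
  finally show ?thesis .
qed

section \<open>Commutation of the translation with lifting and substitution\<close>

locale garbage_increment =
  fixes s :: lterm
  assumes closed_increment: "closed s"
    and increment_plus: "App s G \<rightarrow>\<^sub>\<beta>\<^sup>+ G"
begin

lemma lift_increment [simp]: "lift s k = s"
  by (rule lift_closed[OF closed_increment])

lemma subst_increment [simp]: "subst s r k = s"
  by (rule subst_closed[OF closed_increment])

text \<open>The mutual induction rule treats the first argument as a variable, hence the premise
  \<open>a = s\<close>.\<close>

lemma lift_cps_colon:
  shows "a = s \<Longrightarrow> lift (cps a t) k = cps a (jlift t k)"
    and "a = s \<Longrightarrow> lift (colon a t G K) k = colon a (jlift t k) (lift G k) (lift K k)"
proof (induction a t and a t G K arbitrary: k and k rule: cps_colon.induct)
  case (4 a t u v G K)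
  from 4(1)[OF 4(4)] 4(2)[OF 4(4)] 4(3)[OF 4(4), folded kont_def] 4(4)
  show ?case by (simp add: lift_lift)
qed (auto simp: cps.simps jlift_jlift lift_lift)

lemmas lift_cps = lift_cps_colon(1)[OF refl]
lemmas lift_colon = lift_cps_colon(2)[OF refl]

text \<open>No variable of the lifted term is hit, so this is an equality and not just a
  reduction.\<close>

lemma subst_colon_jlift:
  "subst (colon s (jlift t k) G K) r k = colon s t (subst G r k) (subst K r k)"
  by (induction t arbitrary: k G K r) (auto simp: subst_lift_le simp flip: lift_cps)

lemma cps_app_app: "App (App (cps s t) G) K \<rightarrow>\<^sub>\<beta>\<^sup>+ colon s t G K"
proof -
  have "App (App (cps s t) G) K \<rightarrow>\<^sub>\<beta>\<^sup>+ App (Lam (colon s (jlift t 0) (lift G 0) (Var 0))) K"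
    using AppL[OF beta.beta[of "Lam (colon s (jlift (jlift t 0) 0) (Var 1) (Var 0))" G]]
    \<comment> \<open>Swapping the two lifts exposes an outer lift at 1, the index at which
      \<open>G\<close> is substituted.\<close>
    by (simp add: cps.simps subst_colon_jlift tranclp.r_into_trancl flip: jlift_jlift)
  also have "\<dots> \<rightarrow>\<^sub>\<beta> colon s t G K"
    using beta.beta[of "colon s (jlift t 0) (lift G 0) (Var 0)" K]
    by (simp add: subst_colon_jlift)
  finally show ?thesis .
qed

text \<open>Steps originate only at a variable equal to \<open>k\<close>, where
  \<open>cps a u\<close> lands in head position and absorbs \<open>G\<close> and \<open>K\<close>;
  other variables cost none, so only \<open>\<rightarrow>\<^sub>\<beta>\<^sup>*\<close>
  holds.\<close>

lemma subst_cps_colon: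
  shows "a = s \<Longrightarrow> subst (cps a t) (cps a u) k \<rightarrow>\<^sub>\<beta>\<^sup>* cps a (jsubst t u k)"
    and "a = s \<Longrightarrow> subst (colon a t G K) (cps a u) k
      \<rightarrow>\<^sub>\<beta>\<^sup>* colon a (jsubst t u k) (subst G (cps a u) k) (subst K (cps a u) k)"
proof (induction a t and a t G K arbitrary: u k and u k rule: cps_colon.induct)
  case (1 a t)
  have "subst (colon a (jlift (jlift t 0) 0) (Var 1) (Var 0)) (cps a (jlift (jlift u 0) 0)) (Suc (Suc k))
    \<rightarrow>\<^sub>\<beta>\<^sup>* colon a (jlift (jlift (jsubst t u k) 0) 0) (Var 1) (Var 0)"
    \<comment> \<open>The substitution crosses the binders of \<open>g\<close> and
      \<open>k\<close>.\<close>
    using "1.IH"[OF "1.prems", of "jlift (jlift u 0) 0" "Suc (Suc k)"] by (simp add: jsubst_jlift_le)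
  then have "Lam (Lam (subst (colon a (jlift (jlift t 0) 0) (Var 1) (Var 0)) (cps a (jlift (jlift u 0) 0)) (Suc (Suc k))))
    \<rightarrow>\<^sub>\<beta>\<^sup>* Lam (Lam (colon a (jlift (jlift (jsubst t u k) 0) 0) (Var 1) (Var 0)))"
    by (rule rtranclp_map[rotated]) (auto intro: plus_Lam)
  then show ?case
    using \<open>a = s\<close> by (simp add: cps.simps[of _ t] cps.simps[of _ "jsubst t u k"] lift_cps)
next
  case (2 a i G K)
  then show ?case by (auto intro: cps_app_app[THEN tranclp_into_rtranclp])
next
  case (3 a t G K)
  let ?r = "cps a u"
  have "subst (cps a t) (cps a (jlift u 0)) (Suc k) \<rightarrow>\<^sub>\<beta>\<^sup>* cps a (jsubst t (jlift u 0) (Suc k))"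
    using 3 by blast
  then have "garbage (App (subst K ?r k) (lamval (subst (cps a t) (cps a (jlift u 0)) (Suc k)))) (subst G ?r k)
    \<rightarrow>\<^sub>\<beta>\<^sup>* garbage (App (subst K ?r k) (lamval (cps a (jsubst t (jlift u 0) (Suc k))))) (subst G ?r k)"
    by (rule rtranclp_map[rotated]) (auto intro: plus_garbageL plus_AppR plus_lamval)
  then show ?case using \<open>a = s\<close> by (simp add: lift_cps)
next
  case (4 a t u' v G K)
  let ?r = "cps a u"
  let ?K = "kont (colon a v (lift G 0) (lift K 0)) (cps a u')"
  have "subst (colon a v (lift G 0) (lift K 0)) (cps a (jlift u 0)) (Suc k)
    \<rightarrow>\<^sub>\<beta>\<^sup>* colon a (jsubst v (jlift u 0) (Suc k)) (lift (subst G ?r k) 0) (lift (subst K ?r k) 0)"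
    using 4(1)[OF 4(4), of "jlift u 0" "Suc k"] \<open>a = s\<close> by (simp add: subst_lift_le flip: lift_cps)
  moreover have "subst (cps a u') ?r k \<rightarrow>\<^sub>\<beta>\<^sup>* cps a (jsubst u' u k)"
    using 4 by blast
  ultimately have "subst ?K ?r k \<rightarrow>\<^sub>\<beta>\<^sup>* kont (colon a (jsubst v (jlift u 0) (Suc k))
      (lift (subst G ?r k) 0) (lift (subst K ?r k) 0)) (cps a (jsubst u' u k))"
    using \<open>a = s\<close> by (simp add: lift_cps star_kont)
  moreover have "subst (colon a (JApp t u' v) G K) ?r k
    \<rightarrow>\<^sub>\<beta>\<^sup>* colon a (jsubst t u k) (App a (subst G ?r k)) (subst ?K ?r k)"
    using 4(3)[OF 4(4), of u k] \<open>a = s\<close> by (simp add: kont_def)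
  ultimately show ?case by (simp, meson colon_star_cont rtranclp_trans)
qed

lemmas subst_cps = subst_cps_colon(1)[OF refl]
lemmas subst_colon = subst_cps_colon(2)[OF refl]

section \<open>Simulation of the reduction rules\<close>

lemma colon_beta:
  "colon s (JApp (JLam t) u v) G K \<rightarrow>\<^sub>\<beta>\<^sup>+ colon s (jsubst v (jsubst t u 0) 0) G K"
proof -
  let ?M = "colon s v (lift G 0) (lift K 0)"
  have "colon s (JApp (JLam t) u v) G K \<rightarrow>\<^sub>\<beta>\<^sup>+ App (kont ?M (cps s u)) (lamval (cps s t))"
    \<comment> \<open>The value in head position discards its garbage
      \<open>App s G\<close>.\<close>
    by (simp add: garbage_beta tranclp.r_into_trancl)
  also have "\<dots> \<rightarrow>\<^sub>\<beta>\<^sup>+ App (Lam ?M) (subst (cps s t) (cps s u) 0)"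
    by (rule kont_lamval)
  also have "\<dots> \<rightarrow>\<^sub>\<beta>\<^sup>* App (Lam ?M) (cps s (jsubst t u 0))"
    using subst_cps by (rule rtranclp_map[rotated]) (auto intro: plus_AppR)
  also have "\<dots> \<rightarrow>\<^sub>\<beta> subst ?M (cps s (jsubst t u 0)) 0"
    by (rule beta.beta)
  also have "\<dots> \<rightarrow>\<^sub>\<beta>\<^sup>* colon s (jsubst v (jsubst t u 0) 0) G K"
    \<comment> \<open>\<open>G\<close> and \<open>K\<close> were lifted past \<open>x\<close>, so
      the substitution restores them.\<close>
    using subst_colon[of v "lift G 0" "lift K 0" "jsubst t u 0" 0] by simp
  finally show ?thesis .
qed

text \<open>One level of \<open>gappend\<close>. The premise is only
  \<open>\<rightarrow>\<^sub>\<beta>\<^sup>*\<close> so that it holds by reflexivity when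
  \<open>v\<close> is a value; strictness comes from the garbage.\<close>

lemma colon_pi_step:
  assumes "colon s (japp v (glift S)) (lift G 0) (lift K 0) \<rightarrow>\<^sub>\<beta>\<^sup>* colon s w (lift G 0) (lift K 0)"
  shows "colon s (japp (JApp t u v) S) G K \<rightarrow>\<^sub>\<beta>\<^sup>+ colon s (JApp t u w) G K"
proof -
  obtain u' v' where S: "S = (u', v')" by fastforce
  let ?K = "\<lambda>w. kont (colon s w (lift G 0) (lift K 0)) (cps s u)"
  \<comment> \<open>Lifting the continuation built from \<open>S\<close> yields the one built from
    \<open>glift S\<close>, so the appended form already appears inside.\<close>
  have "colon s (japp (JApp t u v) S) G K =
      colon s t (App s (App s G)) (?K (japp v (glift S)))"
    by (simp add: S lift_colon lift_lift flip: lift_cps)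
  also have "\<dots> \<rightarrow>\<^sub>\<beta>\<^sup>+ colon s t (App s G) (?K (japp v (glift S)))"
    by (intro colon_plus_garbage increment_plus)
  also have "\<dots> \<rightarrow>\<^sub>\<beta>\<^sup>* colon s t (App s G) (?K w)"
    using assms by (intro colon_star_cont star_kont) auto
  finally show ?thesis by simp
qed

lemma colon_pi: "colon s (japp (japp t R) S) G K \<rightarrow>\<^sub>\<beta>\<^sup>+ colon s (japp t (gappend R S)) G K"
proof (induction R S arbitrary: t G K rule: gappend.induct)
  case (3 u t' u' v' S)
  have "colon s (japp (JApp t' u' v') (glift S)) (lift G 0) (lift K 0)
      \<rightarrow>\<^sub>\<beta>\<^sup>* colon s (japp t' (gappend (u', v') (glift S))) (lift G 0) (lift K 0)"
    using 3[of t' "lift G 0" "lift K 0"] by (simp add: tranclp_into_rtranclp)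
  from colon_pi_step[OF this] show ?case by simp
\<comment> \<open>Unfolding \<open>JApp\<close> here would hide the pattern of
  \<open>colon_pi_step\<close>.\<close>
qed (simp_all add: colon_pi_step del: colon_JApp)

lemma cps_plus:
  assumes "\<And>G K. colon s (jlift (jlift t 0) 0) G K \<rightarrow>\<^sub>\<beta>\<^sup>+ colon s (jlift (jlift t' 0) 0) G K"
  shows "cps s t \<rightarrow>\<^sub>\<beta>\<^sup>+ cps s t'"
  by (simp add: cps.simps plus_Lam assms)

text \<open>Translating a subterm lifts it, so the induction is on the size and not on the derivation.\<close>

lemma colon_jred: "t \<rightarrow>\<^sub>J t' \<Longrightarrow> colon s t G K \<rightarrow>\<^sub>\<beta>\<^sup>+ colon s t' G K"
proof (induction "size t" arbitrary: t t' G K rule: less_induct)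
  case less
  have cps_jred: "cps s r \<rightarrow>\<^sub>\<beta>\<^sup>+ cps s r'" if "r \<rightarrow>\<^sub>J r'" "size r < size t" for r r'
    using that by (intro cps_plus less.hyps jred_jlift) auto
  from less.prems show ?case
  proof cases
    case (beta t u v)
    then show ?thesis using colon_beta by simp
  next
    case (pi t R S)
    then show ?thesis using colon_pi by simp
  next
    case (JLam r r')
    then show ?thesis by (simp add: cps_jred plus_garbageL plus_AppR plus_lamval)
  next
    case (JApp1 r r' u v)
    then show ?thesis by (simp add: less.hyps)
  next
    case (JApp2 u u' r v)
    then show ?thesis by (simp add: cps_jred colon_plus_cont plus_kontR)
  next
    case (JApp3 v v' r u)
    then show ?thesis by (simp add: less.hyps colon_plus_cont plus_kontL)
  qed
qed

lemma cps_jred: "t \<rightarrow>\<^sub>J t' \<Longrightarrow> cps s t \<rightarrow>\<^sub>\<beta>\<^sup>+ cps s t'"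
  by (intro cps_plus colon_jred jred_jlift)

end

theorem theorem4p9:
  fixes s :: lterm and t u :: jterm
  assumes "closed s"
    and "\<And>G. App s G \<rightarrow>\<^sub>\<beta>\<^sup>+ G"
    and "t \<rightarrow>\<^sub>J u"
  shows "cps s t \<rightarrow>\<^sub>\<beta>\<^sup>+ cps s u"
proof -
  interpret garbage_increment s
    using assms(1,2) by unfold_locales
  show ?thesis by (rule cps_jred[OF assms(3)])
qed

end
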